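(* The following problem can be polytime-reduced to the circuit equivalence problem for $\mathrm{CC}[2,3,2]$-circuits: given $k,n\in\mathbb{N}$ and expanded polynomials $p_1,\dots,p_k\in\mathbb{Z}_3[x_1,\dots,x_n]$, decide whether $\sum_{i=1}^k\alpha^{p_i(\mathbf{a})}=0$ for all $\mathbf{a}\in\{-1,1\}^n$.
   Context: $\alpha$ is a primitive element of the field $\mathbb{F}_4$; since $\alpha^3=1$, $\alpha^t$ is defined for $t\in\mathbb{Z}_3$; $p_i(\mathbf{a})$ is computed in $\mathbb{Z}_3$ and the sum in $\mathbb{F}_4$. An expanded polynomial is given as $\sum_{\mathbf{e}\in I}c_{\mathbf{e}}x_1^{e_1}\cdots x_n^{e_n}$ with $I\subseteq\{0,1,2\}^n$ and $c_{\mathbf{e}}\in\mathbb{Z}_3\setminus\{0\}$. A $\mathrm{CC}[2,3,2]$-circuit on inputs $y_1,\dots,y_n\in\{0,1\}$ is a depth-3 circuit with unbounded fan-in $\mathrm{MOD}_2$, $\mathrm{MOD}_3$, $\mathrm{MOD}_2$ gates at depths $1,2,3$ (a $\mathrm{MOD}_m$ gate outputs $1$ iff the sum of its inputs, with multiplicity, is divisible by $m$, else $0$), some input wires possibly constant $1$; equivalently an expression $\mathrm{Mod}_2\big(c_0+\sum_{i=1}^k\mathrm{Mod}_3\big(c_1(i)+\sum_{j=1}^{l(i)}\mathrm{Mod}_2(c_2(i,j)+\sum_{m=1}^n e(i,j,m)y_m)\big)\big)$ with nonnegative integer constants, $\mathrm{Mod}_r(z)=1$ iff $r\mid z$. Its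 size is the number of gates. The circuit equivalence problem asks, given such a circuit $C$, whether $C$ evaluates to $1$ on every input vector. Polytime-reducible: there is a polynomial-time transformation $P$ of inputs with $A(e)\iff B(P(e))$. *)

theory Defs
  imports "HOL-Library.Numeral_Type" "HOL-Computational_Algebra.Polynomial"
begin

section \<open>Turing machines\<close>

text \<open>
  Deterministic multitape Turing machines with one-way infinite tapes. States, tape symbols and
  tape cells are natural numbers; the symbol 0 is the blank. A machine with \<open>states M = q\<close> has the
  states \<open>0, \<dots>, q - 1\<close>, the start state 0, and the additional halting state \<open>q\<close>. The
  input is on the first tape, the output on the last one.
\<close>

datatype move = MoveLeft | Stay | MoveRight

type_synonym tape = "(nat \<Rightarrow> nat) \<times> nat"
type_synonym config = "nat \<times> tape list"

record tm =
  tapes :: nat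
  states :: nat
  symbols :: nat
  delta :: "nat \<Rightarrow> nat list \<Rightarrow> nat \<times> (nat \<times> move) list"

definition wf_tm :: "tm \<Rightarrow> bool" where
  "wf_tm M \<longleftrightarrow> tapes M \<ge> 1 \<and> states M \<ge> 1 \<and> symbols M \<ge> 1 \<and>
     (\<forall>q < states M. \<forall>ss. length ss = tapes M \<and> set ss \<subseteq> {..<symbols M} \<longrightarrow>
        fst (delta M q ss) \<le> states M \<and>
        length (snd (delta M q ss)) = tapes M \<and>
        fst ` set (snd (delta M q ss)) \<subseteq> {..<symbols M})"

fun read_tape :: "tape \<Rightarrow> nat" where
  "read_tape (f, h) = f h"

fun move_head :: "move \<Rightarrow> nat \<Rightarrow> nat" where
  "move_head MoveLeft h = h - 1"
| "move_head Stay h = h"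
| "move_head MoveRight h = h + 1"

fun act :: "nat \<times> move \<Rightarrow> tape \<Rightarrow> tape" where
  "act (s, d) (f, h) = (f(h := s), move_head d h)"

fun tm_step :: "tm \<Rightarrow> config \<Rightarrow> config" where
  "tm_step M (q, ts) =
     (if q < states M
      then (let (q', as) = delta M q (map read_tape ts) in (q', map2 act as ts))
      else (q, ts))"

definition word_cells :: "nat list \<Rightarrow> nat \<Rightarrow> nat" where
  "word_cells w = (\<lambda>i. if i < length w then w ! i else 0)"

definition initial_config :: "tm \<Rightarrow> nat list \<Rightarrow> config" where
  "initial_config M w =
     (0, (word_cells w, 0) # replicate (tapes M - 1) (word_cells [], 0))"

definition computes_within :: "tm \<Rightarrow> nat list \<Rightarrow> nat list \<Rightarrow> nat \<Rightarrow> bool" where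
  "computes_within M w v T \<longleftrightarrow> set w \<subseteq> {..<symbols M} \<and>
     (\<exists>t \<le> T. \<exists>ts. (tm_step M ^^ t) (initial_config M w) = (states M, ts) \<and>
        fst (last ts) = word_cells v)"


section \<open>Decision problems and polynomial-time reductions\<close>

record 'a problem =
  inputs :: "'a set"
  encode :: "'a \<Rightarrow> nat list"
  accepts :: "'a \<Rightarrow> bool"

definition polytime_transformation ::
  "('a, 'x) problem_scheme \<Rightarrow> ('b, 'y) problem_scheme \<Rightarrow> ('a \<Rightarrow> 'b) \<Rightarrow> bool" where
  "polytime_transformation A B P \<longleftrightarrow> P ` inputs A \<subseteq> inputs B \<and>
     (\<exists>M. wf_tm M \<and> (\<exists>p :: nat poly. \<forall>e \<in> inputs A.
        computes_within M (encode A e) (encode B (P e)) (poly p (length (encode A e)))))"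

definition polytime_reducible ::
  "('a, 'x) problem_scheme \<Rightarrow> ('b, 'y) problem_scheme \<Rightarrow> bool" where
  "polytime_reducible A B \<longleftrightarrow>
     (\<exists>P. polytime_transformation A B P \<and> (\<forall>e \<in> inputs A. accepts A e \<longleftrightarrow> accepts B (P e)))"


section \<open>Encoding of inputs as words\<close>

abbreviation (input) sym0 :: nat where "sym0 \<equiv> 1"
abbreviation (input) sym1 :: nat where "sym1 \<equiv> 2"
abbreviation (input) sym_end :: nat where "sym_end \<equiv> 3"
abbreviation (input) sym_open :: nat where "sym_open \<equiv> 4"
abbreviation (input) sym_close :: nat where "sym_close \<equiv> 5"

text \<open>Binary representation, least significant digit first, without leading zeros.\<close>

fun binary :: "nat \<Rightarrow> nat list" where
  "binary n = (if n = 0 then [] else (if even n then sym0 else sym1) # binary (n div 2))"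

declare binary.simps [simp del]

definition enc_nat :: "nat \<Rightarrow> nat list" where
  "enc_nat n = binary n @ [sym_end]"

text \<open>Unary representation, used only for the number of variables: variables are listed one by
  one, so that an input in \<open>n\<close> variables has length at least \<open>n\<close>.\<close>

definition enc_unary :: "nat \<Rightarrow> nat list" where
  "enc_unary n = replicate n sym1 @ [sym_end]"

definition enc_list :: "('a \<Rightarrow> nat list) \<Rightarrow> 'a list \<Rightarrow> nat list" where
  "enc_list f xs = sym_open # concat (map f xs) @ [sym_close]"


section \<open>Sums of powers of a primitive element\<close>

text \<open>
  The ring of integers modulo 3 is the type \<open>3\<close>; \<open>Rep_bit1\<close> yields the representative
  in \<open>{0, 1, 2}\<close>. An expanded polynomial is the list of its terms, each
  consisting of the coefficient and the list of the exponents of \<open>x\<^sub>1, \<dots>, x\<^sub>n\<close>.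
\<close>

type_synonym z3 = "3"
type_synonym expanded_poly = "(z3 \<times> nat list) list"

definition z3_rep :: "z3 \<Rightarrow> nat" where
  "z3_rep t = nat (Rep_bit1 t)"

definition expanded_polys :: "nat \<Rightarrow> expanded_poly set" where
  "expanded_polys n = {p. distinct (map snd p) \<and>
     (\<forall>(c, es) \<in> set p. c \<noteq> 0 \<and> length es = n \<and> set es \<subseteq> {0, 1, 2})}"

definition eval_poly :: "nat \<Rightarrow> expanded_poly \<Rightarrow> z3 list \<Rightarrow> z3" where
  "eval_poly n p a = (\<Sum>(c, es) \<leftarrow> p. c * (\<Prod>i<n. (a ! i) ^ (es ! i)))"

definition primitive_element :: "'f::field \<Rightarrow> bool" where
  "primitive_element \<alpha> \<longleftrightarrow> range (\<lambda>i::nat. \<alpha> ^ i) = UNIV - {0}"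

definition power_sum_problem :: "'f::field \<Rightarrow> (nat \<times> expanded_poly list) problem" where
  "power_sum_problem \<alpha> = \<lparr>
     inputs = {(n, ps). set ps \<subseteq> expanded_polys n},
     encode = (\<lambda>(n, ps). enc_unary n @
       enc_list (enc_list (\<lambda>(c, es). enc_nat (z3_rep c) @ enc_list enc_nat es)) ps),
     accepts = (\<lambda>(n, ps). \<forall>a. length a = n \<and> set a \<subseteq> {-1, 1} \<longrightarrow>
       (\<Sum>i < length ps. \<alpha> ^ z3_rep (eval_poly n (ps ! i) a)) = 0) \<rparr>"


section \<open>CC[2,3,2]-circuits\<close>

text \<open>
  A \<open>MOD\<^sub>2\<close> gate of depth 1 is a pair \<open>(c\<^sub>2, es)\<close> of the number of its constant wires and the list of the
  multiplicities of the input variables; a \<open>MOD\<^sub>3\<close> gate of depth 2 is a pair \<open>(c\<^sub>1, gs)\<close> with the list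
  of the gates wired to it; a circuit \<open>(n, c\<^sub>0, hs)\<close> consists of the number of
  input variables and the data of the output gate.
\<close>

type_synonym mod2_gate = "nat \<times> nat list"
type_synonym mod3_gate = "nat \<times> mod2_gate list"
type_synonym cc232_circuit = "nat \<times> nat \<times> mod3_gate list"

definition Mod :: "nat \<Rightarrow> nat \<Rightarrow> nat" where
  "Mod r z = (if r dvd z then 1 else 0)"

definition cc232_circuits :: "cc232_circuit set" where
  "cc232_circuits = {(n, c0, hs). \<forall>(c1, gs) \<in> set hs. \<forall>(c2, es) \<in> set gs. length es = n}"

fun eval_circuit :: "cc232_circuit \<Rightarrow> nat list \<Rightarrow> nat" where
  "eval_circuit (n, c0, hs) y =
     Mod 2 (c0 + (\<Sum>(c1, gs) \<leftarrow> hs.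
       Mod 3 (c1 + (\<Sum>(c2, es) \<leftarrow> gs.
         Mod 2 (c2 + (\<Sum>m<n. es ! m * y ! m))))))"

definition cc232_equivalence_problem :: "cc232_circuit problem" where
  "cc232_equivalence_problem = \<lparr>
     inputs = cc232_circuits,
     encode = (\<lambda>(n, c0, hs). enc_unary n @ enc_nat c0 @
       enc_list (\<lambda>(c1, gs). enc_nat c1 @
         enc_list (\<lambda>(c2, es). enc_nat c2 @ enc_list enc_nat es) gs) hs),
     accepts = (\<lambda>C. \<forall>y. length y = fst C \<and> set y \<subseteq> {0, 1} \<longrightarrow> eval_circuit C y = 1) \<rparr>"

end

theory Submission imports Defs "HOL-Combinatorics.Transposition" begin

text \<open>
  For \<open>a = ((-1)\<^bsup>y\<^esup>)\<close> a term \<open>c x\<^bsup>e\<^esup>\<close> takes the value \<open>c (-1)\<^bsup>s\<^esup> = 1 + Mod\<^sub>2 (c + s)\<close> in the integers modulo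
  3, where \<open>s = \<Sum> e\<^sub>m y\<^sub>m\<close>. Adding a new variable \<open>z\<close> with multiplicity 1 to every gate of depth 1
  multiplies the polynomial by \<open>(-1)\<^bsup>z\<^esup>\<close>; hence a single \<open>MOD\<^sub>3\<close> gate computes whether
  \<open>1 + (-1)\<^bsup>z\<^esup> p\<^sub>i(a) = 0\<close>, that is, whether \<open>p\<^sub>i(a) = 2\<close> (for \<open>z = 0\<close>) or \<open>p\<^sub>i(a) = 1\<close> (for \<open>z = 1\<close>).
  If \<open>N\<^sub>j\<close> is the number of the \<open>i\<close> with \<open>p\<^sub>i(a) = j\<close>, then \<open>N\<^sub>0 + N\<^sub>1 \<alpha> + N\<^sub>2 \<alpha>\<^sup>2 = 0\<close> holds in the field with 4
  elements iff the \<open>N\<^sub>j\<close> have the same parity, which is the parity of \<open>k\<close>; so it suffices that \<open>N\<^sub>1\<close> and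
  \<open>N\<^sub>2\<close> have the parity of \<open>k\<close>, and this is what the output gate tests.

  A Turing machine computes the circuit in linear time: a finite transducer reads the
  input once and pushes the encoded gates onto a stack, which is finally emptied onto the output tape.
\<close>

section \<open>Transducers with a stack\<close>

lemma word_cells_append: "(word_cells u)(length u := s) = word_cells (u @ [s])"
  by (auto simp: word_cells_def nth_append fun_eq_iff)

lemma word_cells_nth_append: "word_cells (u @ s # v) (length u) = s"
  by (simp add: word_cells_def)

lemma word_cells_length: "word_cells u (length u) = 0"
  by (simp add: word_cells_def)

lemma funpow_1: "(f :: 'a \<Rightarrow> 'a) ^^ 1 = f"
  by (simp add: fun_eq_iff)

text \<open>The output word of a Mealy machine. It is used twice with the same transitions: for the
  letters written directly and for the letters pushed.\<close>

fun emission :: "('q \<Rightarrow> nat \<Rightarrow> 'q) \<Rightarrow> ('q \<Rightarrow> nat \<Rightarrow> nat list) \<Rightarrow> 'q \<Rightarrow> nat list \<Rightarrow> nat list" where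
  "emission f g q [] = []"
| "emission f g q (a # w) = g q a @ emission f g (f q a) w"

lemma emission_append:
  "emission f g q (w @ w') = emission f g q w @ emission f g (foldl f q w) w'"
  by (induction w arbitrary: q) auto

text \<open>The two lists hold the letters still waiting for the output tape and for the stack, in
  this order.\<close>

datatype 'q control = Scan 'q "nat list" "nat list" | Rewind

locale stack_transducer =
  fixes Q :: "'q set" and start :: 'q and nxt :: "'q \<Rightarrow> nat \<Rightarrow> 'q"
    and direct push :: "'q \<Rightarrow> nat \<Rightarrow> nat list" and K B :: nat
  assumes finite_Q: "finite Q"
    and start_Q: "start \<in> Q"
    and next_Q: "q \<in> Q \<Longrightarrow> nxt q a \<in> Q"
    and direct_symbols: "q \<in> Q \<Longrightarrow> set (direct q a) \<subseteq> {..<K}"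
    and push_symbols: "q \<in> Q \<Longrightarrow> set (push q a) \<subseteq> {..<K}"
    and direct_length: "q \<in> Q \<Longrightarrow> length (direct q a) \<le> B"
    and push_length: "q \<in> Q \<Longrightarrow> length (push q a) \<le> B"
begin

definition buffers :: "nat list set" where
  "buffers = {l. set l \<subseteq> {..K} \<and> length l \<le> Suc B}"

lemma Nil_buffers: "[] \<in> buffers"
  by (simp add: buffers_def)

lemma Cons_buffersD: "a # l \<in> buffers \<Longrightarrow> a \<le> K \<and> l \<in> buffers"
  by (simp add: buffers_def)

definition controls :: "'q control set" where
  "controls = insert Rewind ((\<lambda>(q, ds, ps). Scan q ds ps) ` (Q \<times> buffers \<times> buffers))"

text \<open>The letters emitted on reading a symbol are buffered in the control state and written one by
  one. The symbol \<open>K\<close>, which is never emitted, marks the bottom of the stack on the second tape;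
  after the input has been read, the stack is emptied onto the output tape, hence reversed.\<close>

fun control_step ::
  "'q control \<Rightarrow> nat \<Rightarrow> nat \<Rightarrow> nat \<Rightarrow> 'q control option \<times> (nat \<times> move) list" where
  "control_step (Scan q (d # ds) ps) x y z =
     (Some (Scan q ds ps), [(x, Stay), (y, Stay), (d, MoveRight)])"
| "control_step (Scan q [] (p # ps)) x y z =
     (Some (Scan q [] ps), [(x, Stay), (p, MoveRight), (z, Stay)])"
| "control_step (Scan q [] []) x y z =
     (if x = 0 then (Some Rewind, [(x, Stay), (y, MoveLeft), (z, Stay)])
      else (Some (Scan (nxt q x) (direct q x) (push q x)),
            [(x, MoveRight), (y, Stay), (z, Stay)]))"
| "control_step Rewind x y z =
     (if y = K then (None, [(x, Stay), (y, Stay), (z, Stay)])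
      else (Some Rewind, [(x, Stay), (y, MoveLeft), (y, MoveRight)]))"

abbreviation initial_control :: "'q control" where
  "initial_control \<equiv> Scan start [] [K]"

section \<open>Numbering of the control states and the machine\<close>

definition code :: "'q control \<Rightarrow> nat" where
  "code = (SOME h. bij_betw h controls {..<card controls} \<and> h initial_control = 0)"

definition machine :: tm where
  "machine = \<lparr>tapes = 3, states = card controls, symbols = Suc K,
     delta = (\<lambda>i ss. map_prod (case_option (card controls) code) id
       (control_step (inv_into controls code i) (ss ! 0) (ss ! 1) (ss ! 2)))\<rparr>"

lemma finite_controls: "finite controls"
  unfolding controls_def buffers_def
  by (intro finite.insertI finite_imageI finite_cartesian_product finite_Q
      finite_lists_length_le finite_atMost)

lemma Rewind_controls: "Rewind \<in> controls"
  by (simp add: controls_def)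

lemma Scan_controls: "Scan q ds ps \<in> controls \<longleftrightarrow> q \<in> Q \<and> ds \<in> buffers \<and> ps \<in> buffers"
  by (force simp: controls_def)

lemma initial_control: "initial_control \<in> controls"
  using start_Q by (simp add: Scan_controls buffers_def)

text \<open>The start state of a machine is 0, so an arbitrary numbering is followed by the
  transposition that exchanges 0 with the number of the initial control.\<close>

lemma code: "bij_betw code controls {..<card controls}" "code initial_control = 0"
proof -
  obtain h where h: "bij_betw h controls {..<card controls}"
    using ex_bij_betw_finite_nat[OF finite_controls] by (auto simp: atLeast0LessThan)
  have "h initial_control < card controls"
    using h initial_control by (auto simp: bij_betw_def)
  then have "bij_betw (transpose (h initial_control) 0 \<circ> h) controls {..<card controls}"
    using h by (intro bij_betw_trans[OF h]) (auto simp: bij_betw_transpose_iff)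
  moreover have "(transpose (h initial_control) 0 \<circ> h) initial_control = 0"
    by simp
  ultimately have "\<exists>h. bij_betw h controls {..<card controls} \<and> h initial_control = 0"
    by blast
  from someI_ex[OF this]
  show "bij_betw code controls {..<card controls}" "code initial_control = 0"
    by (auto simp: code_def)
qed

lemma code_less: "s \<in> controls \<Longrightarrow> code s < card controls"
  using code(1) by (auto simp: bij_betw_def)

lemma inv_code: "s \<in> controls \<Longrightarrow> inv_into controls code (code s) = s"
  using code(1) by (simp add: bij_betw_def)

lemma inv_code_controls: "i < card controls \<Longrightarrow> inv_into controls code i \<in> controls"
  using code(1) by (auto simp: bij_betw_def intro: inv_into_into)

lemma Scan_next_controls:
  assumes "q \<in> Q"
  shows "Scan (nxt q a) (direct q a) (push q a) \<in> controls"
proof -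
  have "{..<K} \<subseteq> {..K}"
    by auto
  then have "direct q a \<in> buffers" "push q a \<in> buffers"
    unfolding buffers_def using direct_symbols[OF assms, of a] push_symbols[OF assms, of a]
      direct_length[OF assms, of a] push_length[OF assms, of a]
    by (simp_all add: le_SucI subset_trans[of _ "{..<K}"])
  then show ?thesis
    using next_Q[OF assms] by (simp add: Scan_controls)
qed

text \<open>Buffers only shrink until both are empty; then a letter is read and the bounds on
  \<open>direct\<close> and \<open>push\<close> apply.\<close>

lemma control_step_wf:
  assumes "s \<in> controls" "x \<le> K" "y \<le> K" "z \<le> K"
  shows "pred_option (\<lambda>s'. s' \<in> controls) (fst (control_step s x y z))"
    and "length (snd (control_step s x y z)) = 3"
    and "fst ` set (snd (control_step s x y z)) \<subseteq> {..K}"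
proof -
  have "pred_option (\<lambda>s'. s' \<in> controls) (fst (control_step s x y z)) \<and>
    length (snd (control_step s x y z)) = 3 \<and>
    fst ` set (snd (control_step s x y z)) \<subseteq> {..K}"
  proof (cases s)
    case Rewind
    then show ?thesis
      using assms Rewind_controls by simp
  next
    case (Scan q ds ps)
    then have *: "q \<in> Q" "ds \<in> buffers" "ps \<in> buffers"
      using assms(1) by (simp_all add: Scan_controls)
    show ?thesis
    proof (cases ds)
      case (Cons d ds')
      then show ?thesis
        using Scan * assms Cons_buffersD[of d ds'] by (simp add: Scan_controls)
    next
      case Nil
      show ?thesis
      proof (cases ps)
        case (Cons p ps')
        then show ?thesis
          using Scan Nil * assms Cons_buffersD[of p ps'] by (simp add: Scan_controls)
      next
        case [simp]: Nil
        show ?thesis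
          using Scan \<open>ds = []\<close> * assms Scan_next_controls[of q x] Rewind_controls by simp
      qed
    qed
  qed
  then show "pred_option (\<lambda>s'. s' \<in> controls) (fst (control_step s x y z))"
    and "length (snd (control_step s x y z)) = 3"
    and "fst ` set (snd (control_step s x y z)) \<subseteq> {..K}"
    by simp_all
qed

lemma wf_machine: "wf_tm machine"
  unfolding wf_tm_def
proof (intro conjI allI impI)
  show "states machine \<ge> 1"
    using finite_controls Rewind_controls by (auto simp: machine_def Suc_le_eq card_gt_0_iff)
next
  fix i ss assume i: "i < states machine"
    and ss: "length ss = tapes machine \<and> set ss \<subseteq> {..<symbols machine}"
  define r where "r = control_step (inv_into controls code i) (ss ! 0) (ss ! 1) (ss ! 2)"
  have "ss ! j \<le> K" if "j < 3" for j
    using ss that nth_mem[of j ss] by (force simp: machine_def less_Suc_eq_le)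
  then have r: "pred_option (\<lambda>s'. s' \<in> controls) (fst r)" "length (snd r) = 3"
    "fst ` set (snd r) \<subseteq> {..K}"
    using i control_step_wf[OF inv_code_controls, of i "ss ! 0" "ss ! 1" "ss ! 2"]
    by (simp_all add: r_def machine_def)
  have d: "delta machine i ss = map_prod (case_option (card controls) code) id r"
    and m: "states machine = card controls" "tapes machine = 3" "symbols machine = Suc K"
    by (simp_all add: machine_def r_def)
  show "fst (delta machine i ss) \<le> states machine"
    using r(1) code_less by (cases "fst r") (auto simp: d m less_imp_le)
  show "length (snd (delta machine i ss)) = tapes machine"
    using r(2) by (simp add: d m)
  show "fst ` set (snd (delta machine i ss)) \<subseteq> {..<symbols machine}"
    using r(3) by (auto simp: d m less_Suc_eq_le)
qed (auto simp: machine_def)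

section \<open>Runs of the machine\<close>

lemma machine_step:
  assumes "s \<in> controls"
  shows "tm_step machine (code s, [t0, t1, t2]) =
    map_prod (case_option (card controls) code) (\<lambda>as. map2 act as [t0, t1, t2])
      (control_step s (read_tape t0) (read_tape t1) (read_tape t2))"
  using assms code_less[OF assms(1)]
  by (simp add: machine_def inv_code map_prod_def split: prod.split)

text \<open>The head stands on the cell just behind \<open>v\<close>, so each step appends one
  buffered letter.\<close>

lemma run_direct:
  assumes "Scan q ds ps \<in> controls"
  shows "(tm_step machine ^^ length ds)
      (code (Scan q ds ps), [(f, i), (g, j), (word_cells v, length v)]) =
    (code (Scan q [] ps), [(f, i), (g, j), (word_cells (v @ ds), length (v @ ds))])"
  using assms
proof (induction ds arbitrary: v)
  case (Cons d ds)
  have "Scan q ds ps \<in> controls"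
    using Cons.prems Cons_buffersD[of d ds] by (simp add: Scan_controls)
  moreover have "tm_step machine
      (code (Scan q (d # ds) ps), [(f, i), (g, j), (word_cells v, length v)]) =
    (code (Scan q ds ps), [(f, i), (g, j), (word_cells (v @ [d]), length (v @ [d]))])"
    by (subst machine_step[OF Cons.prems]) (simp add: word_cells_append)
  ultimately show ?case
    using Cons.IH[of "v @ [d]"]
    by (simp only: length_Cons funpow_Suc_right o_apply append_assoc append_Cons append_Nil)
qed simp

lemma run_push:
  assumes "Scan q [] ps \<in> controls"
  shows "(tm_step machine ^^ length ps)
      (code (Scan q [] ps), [(f, i), (word_cells u, length u), (g, j)]) =
    (code (Scan q [] []), [(f, i), (word_cells (u @ ps), length (u @ ps)), (g, j)])"
  using assms
proof (induction ps arbitrary: u)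
  case (Cons p ps)
  have "Scan q [] ps \<in> controls"
    using Cons.prems Cons_buffersD[of p ps] by (simp add: Scan_controls)
  moreover have "tm_step machine
      (code (Scan q [] (p # ps)), [(f, i), (word_cells u, length u), (g, j)]) =
    (code (Scan q [] ps), [(f, i), (word_cells (u @ [p]), length (u @ [p])), (g, j)])"
    by (subst machine_step[OF Cons.prems]) (simp add: word_cells_append)
  ultimately show ?case
    using Cons.IH[of "u @ [p]"]
    by (simp only: length_Cons funpow_Suc_right o_apply append_assoc append_Cons append_Nil)
qed simp

text \<open>The exponent is executed from right to left: one step reads \<open>a\<close>, then
  \<open>direct q a\<close> is written, then \<open>push q a\<close>. A blank would be taken for the
  end of the input.\<close>

lemma run_letter:
  assumes "q \<in> Q" "a \<noteq> 0"
  shows "(tm_step machine ^^ (length (push q a) + (length (direct q a) + 1)))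
      (code (Scan q [] []), [(word_cells (x @ a # w), length x), (word_cells u, length u),
        (word_cells v, length v)]) =
    (code (Scan (nxt q a) [] []), [(word_cells (x @ a # w), Suc (length x)),
      (word_cells (u @ push q a), length (u @ push q a)),
      (word_cells (v @ direct q a), length (v @ direct q a))])"
proof -
  have S: "Scan q [] [] \<in> controls" "Scan (nxt q a) (direct q a) (push q a) \<in> controls"
    "Scan (nxt q a) [] (push q a) \<in> controls"
    using assms Scan_next_controls[of q a] by (simp_all add: Scan_controls Nil_buffers)
  have "tm_step machine
      (code (Scan q [] []), [(word_cells (x @ a # w), length x), (word_cells u, length u),
        (word_cells v, length v)]) =
    (code (Scan (nxt q a) (direct q a) (push q a)),
      [(word_cells (x @ a # w), Suc (length x)), (word_cells u, length u),
        (word_cells v, length v)])"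
    using assms(2) word_cells_nth_append[of x a w]
      fun_upd_triv[of "word_cells (x @ a # w)" "length x"]
    by (subst machine_step[OF S(1)]) simp
  then show ?thesis
    unfolding funpow_add o_apply
    by (simp only: funpow_1 run_direct[OF S(2)] run_push[OF S(3)])
qed

text \<open>Each letter costs one reading step and at most \<open>B\<close> writing steps on each of
  two tapes.\<close>

lemma run_scan:
  assumes "q \<in> Q" "0 \<notin> set w"
  shows "\<exists>t \<le> (1 + 2 * B) * length w. (tm_step machine ^^ t)
      (code (Scan q [] []), [(word_cells (x @ w), length x), (word_cells u, length u),
        (word_cells v, length v)]) =
    (code (Scan (foldl nxt q w) [] []), [(word_cells (x @ w), length (x @ w)),
      (word_cells (u @ emission nxt push q w), length (u @ emission nxt push q w)),
      (word_cells (v @ emission nxt direct q w), length (v @ emission nxt direct q w))])"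
  using assms
proof (induction w arbitrary: q x u v)
  case Nil
  show ?case
    by (intro exI[of _ 0]) simp
next
  case (Cons a w)
  obtain t where t: "t \<le> (1 + 2 * B) * length w" "(tm_step machine ^^ t)
      (code (Scan (nxt q a) [] []), [(word_cells ((x @ [a]) @ w), length (x @ [a])),
        (word_cells (u @ push q a), length (u @ push q a)),
        (word_cells (v @ direct q a), length (v @ direct q a))]) =
    (code (Scan (foldl nxt (nxt q a) w) [] []),
      [(word_cells ((x @ [a]) @ w), length ((x @ [a]) @ w)),
      (word_cells ((u @ push q a) @ emission nxt push (nxt q a) w),
       length ((u @ push q a) @ emission nxt push (nxt q a) w)),
      (word_cells ((v @ direct q a) @ emission nxt direct (nxt q a) w),
       length ((v @ direct q a) @ emission nxt direct (nxt q a) w))])"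
    using Cons.IH[of "nxt q a" "x @ [a]" "u @ push q a" "v @ direct q a"] Cons.prems next_Q
    by auto
  show ?case
  proof (intro exI conjI)
    show "t + (length (push q a) + (length (direct q a) + 1)) \<le> (1 + 2 * B) * length (a # w)"
      using t(1) direct_length[of q a] push_length[of q a] Cons.prems by simp
    show "(tm_step machine ^^ (t + (length (push q a) + (length (direct q a) + 1))))
        (code (Scan q [] []), [(word_cells (x @ a # w), length x), (word_cells u, length u),
          (word_cells v, length v)]) =
      (code (Scan (foldl nxt q (a # w)) [] []), [(word_cells (x @ a # w), length (x @ a # w)),
        (word_cells (u @ emission nxt push q (a # w)),
         length (u @ emission nxt push q (a # w))),
        (word_cells (v @ emission nxt direct q (a # w)),
         length (v @ emission nxt direct q (a # w)))])"
      unfolding funpow_add[of t] o_apply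
      using Cons.prems t(2) run_letter[of q a x w u v] by simp
  qed
qed

text \<open>Here \<open>u\<close> is still to be copied, while \<open>x\<close> has been copied and
  stays on the tape; hence the induction removes the last letter of \<open>u\<close>. Cell 0 holds
  \<open>K\<close>, so \<open>length u\<close> is the position of the top.\<close>

lemma run_rewind:
  assumes "K \<notin> set u"
  shows "(tm_step machine ^^ (Suc (length u)))
      (code Rewind, [(f, i), (word_cells (K # u @ x), length u), (word_cells v, length v)]) =
    (card controls, [(f, i), (word_cells (K # u @ x), 0),
      (word_cells (v @ rev u), length (v @ rev u))])"
  using assms
proof (induction u arbitrary: x v rule: rev_induct)
  case Nil
  have "word_cells (K # x) 0 = K"
    by (simp add: word_cells_def)
  then show ?case
    using word_cells_length[of v] by (simp add: machine_step Rewind_controls fun_upd_idem del: tm_step.simps)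
next
  case (snoc a u)
  have "word_cells (K # u @ a # x) (Suc (length u)) = a"
    by (simp add: word_cells_def)
  then have "tm_step machine
      (code Rewind, [(f, i), (word_cells (K # u @ a # x), Suc (length u)), (word_cells v, length v)]) =
    (code Rewind, [(f, i), (word_cells (K # u @ a # x), length u),
      (word_cells (v @ [a]), length (v @ [a]))])"
    using snoc.prems
    by (subst machine_step[OF Rewind_controls]) (simp add: word_cells_append fun_upd_idem)
  then show ?case
    using snoc.IH[of "a # x" "v @ [a]"] snoc.prems
    by (simp add: funpow_Suc_right[of "Suc (length u)"] del: funpow.simps tm_step.simps)
qed

lemma emission_symbols: "q \<in> Q \<Longrightarrow> set (emission nxt push q w) \<subseteq> {..<K}"
  by (induction w arbitrary: q) (use push_symbols next_Q in auto)

lemma emission_length: "q \<in> Q \<Longrightarrow> length (emission nxt push q w) \<le> B * length w"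
proof (induction w arbitrary: q)
  case (Cons a w)
  then show ?case
    using push_length[of q a] Cons.IH[OF next_Q[of q a]] by simp
qed simp

text \<open>The polynomial adds one step for the marker, at most
  \<open>(1 + 2 * B) * length w\<close> for the scan, one for turning back and at most
  \<open>B * length w + 1\<close> for emptying the stack.\<close>

theorem computes_emission:
  assumes w: "set w \<subseteq> {0<..<K}"
  shows "computes_within machine w
    (emission nxt direct start w @ rev (emission nxt push start w))
    (poly [:3, 1 + 3 * B:] (length w))"
proof -
  let ?u = "emission nxt push start w" and ?v = "emission nxt direct start w"
  let ?q = "foldl nxt start w"
  have Q: "?q \<in> Q"
    using start_Q next_Q by (induction w rule: rev_induct) auto
  have 0: "0 \<notin> set w"
    using w by auto
  obtain t where t: "t \<le> (1 + 2 * B) * length w" "(tm_step machine ^^ t)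
      (code (Scan start [] []), [(word_cells w, 0), (word_cells [K], 1), (word_cells [], 0)]) =
    (code (Scan ?q [] []),
      [(word_cells w, length w), (word_cells (K # ?u), length (K # ?u)), (word_cells ?v, length ?v)])"
    using run_scan[OF start_Q, of w "[]" "[K]" "[]"] 0 by auto
  \<comment> \<open>The first step empties the initial buffer \<open>[K]\<close> and so puts the
    bottom marker on the stack.\<close>
  have 1: "tm_step machine (initial_config machine w) =
      (code (Scan start [] []), [(word_cells w, 0), (word_cells [K], 1), (word_cells [], 0)])"
    using run_push[OF initial_control, of "word_cells w" 0 "[]" "word_cells []" 0] code(2)
    by (simp add: initial_config_def machine_def numeral_2_eq_2 del: tm_step.simps)
  have 2: "tm_step machine (code (Scan ?q [] []),
      [(word_cells w, length w), (word_cells (K # ?u), length (K # ?u)), (word_cells ?v, length ?v)]) =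
    (code Rewind, [(word_cells w, length w), (word_cells (K # ?u), length ?u), (word_cells ?v, length ?v)])"
    using Q word_cells_length[of w] word_cells_length[of ?v] word_cells_length[of "K # ?u"]
    by (subst machine_step) (simp_all add: Scan_controls Nil_buffers fun_upd_idem)
  have 3: "(tm_step machine ^^ (Suc (length ?u)))
      (code Rewind, [(word_cells w, length w), (word_cells (K # ?u), length ?u), (word_cells ?v, length ?v)]) =
    (card controls, [(word_cells w, length w), (word_cells (K # ?u), 0),
      (word_cells (?v @ rev ?u), length (?v @ rev ?u))])"
    using run_rewind[of ?u "word_cells w" "length w" "[]" ?v] emission_symbols[OF start_Q, of w]
    by auto
  have "(tm_step machine ^^ (Suc (length ?u) + (1 + (t + 1)))) (initial_config machine w) =
    (card controls, [(word_cells w, length w), (word_cells (K # ?u), 0),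
      (word_cells (?v @ rev ?u), length (?v @ rev ?u))])"
    unfolding funpow_add o_apply funpow_1 by (simp only: funpow_1 1 t(2) 2 3)
  moreover have "Suc (length ?u) + (1 + (t + 1)) \<le> poly [:3, 1 + 3 * B:] (length w)"
    using t(1) emission_length[OF start_Q, of w] by (simp add: algebra_simps)
  moreover have "set w \<subseteq> {..<symbols machine}"
    using w by (auto simp: machine_def)
  ultimately show ?thesis
    unfolding computes_within_def
    by (intro conjI exI[of _ "Suc (length ?u) + (1 + (t + 1))"]) (auto simp: machine_def)
qed

end

section \<open>Correctness of the reduction\<close>

lemma z3_cases: obtains "x = (0 :: z3)" | "x = 1" | "x = 2"
proof (cases x rule: bit1_cases)
  case (of_int i)
  then have "i = 0 \<or> i = 1 \<or> i = 2"
    by auto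
  then show ?thesis
    using of_int that by auto
qed

lemma z3_rep_simps [simp]: "z3_rep 0 = 0" "z3_rep 1 = 1" "z3_rep 2 = 2"
  by (simp_all add: z3_rep_def bit1.Rep_0 bit1.Rep_1 bit1.Rep_numeral)

lemma of_nat_z3_rep: "of_nat (z3_rep x) = x"
  by (cases x rule: z3_cases) auto

lemma of_nat_z3_eq_0: "of_nat t = (0 :: z3) \<longleftrightarrow> 3 dvd t"
  by (simp add: of_nat_eq_0_iff_char_dvd)

text \<open>Nonzero coefficients are signs, so only the parity of \<open>z3_rep c + s\<close>
  matters; the gate value 0 stands for 1, and the gate value 1 for 1 + 1 = -1.\<close>

lemma Mod2_gate:
  assumes "c \<noteq> (0 :: z3)"
  shows "of_nat (Mod 2 (z3_rep c + s)) + 1 = c * (-1) ^ s"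
  using assms by (cases c rule: z3_cases; cases "even s") (auto simp: Mod_def)

text \<open>The final 1 is the multiplicity of the new variable. The exponents are reversed because
  they pass through the stack.\<close>

definition term_gate :: "z3 \<times> nat list \<Rightarrow> mod2_gate" where
  "term_gate = (\<lambda>(c, es). (z3_rep c, rev es @ [1]))"

text \<open>The gate \<open>(0, [])\<close> is constantly 1 and contributes the parity of the number of polynomials.\<close>

definition poly_gates :: "expanded_poly \<Rightarrow> mod3_gate list" where
  "poly_gates p = [(z3_rep (1 + of_nat (length p)), rev (map term_gate p)), (0, [])]"

text \<open>The constant of the output gate precedes the gates in the encoding and is written before
  any polynomial is read. It is therefore fixed to 0, and the constant gates supply the parity
  instead.\<close>

definition reduction :: "nat \<times> expanded_poly list \<Rightarrow> cc232_circuit" where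
  "reduction = (\<lambda>(n, ps). (Suc n, 0, rev (concat (map poly_gates ps))))"

lemma reduction_inputs:
  "e \<in> inputs (power_sum_problem \<alpha>) \<Longrightarrow> reduction e \<in> inputs cc232_equivalence_problem"
  by (fastforce simp: power_sum_problem_def cc232_equivalence_problem_def cc232_circuits_def
      reduction_def poly_gates_def term_gate_def expanded_polys_def)

text \<open>Exponents and inputs are reversed alike, so reindexing restores the original sum; the
  last position contributes \<open>z\<close>.\<close>

lemma term_gate_input:
  fixes es b :: "nat list"
  assumes "length es = n" "length b = n"
  shows "(\<Sum>m<Suc n. (rev es @ [1]) ! m * (rev b @ [z]) ! m) = z + (\<Sum>i<n. es ! i * b ! i)"
proof -
  have "(\<Sum>m<n. (rev es @ [1]) ! m * (rev b @ [z]) ! m) = (\<Sum>m<n. es ! (n - Suc m) * b ! (n - Suc m))"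
    using assms by (intro sum.cong) (auto simp: nth_append rev_nth)
  then show ?thesis
    using assms sum.nat_diff_reindex[of "\<lambda>i. es ! i * b ! i" n] by (simp add: nth_append)
qed

text \<open>By \<open>Mod2_gate\<close> each gate falls short of its term by 1; the summand
  \<open>length p\<close> makes up for this and is part of the constant in
  \<open>poly_gates\<close>.\<close>

lemma Mod3_gate:
  assumes "\<forall>(c, es) \<in> set p. c \<noteq> 0 \<and> length es = n" "length b = n"
  shows "(of_nat (\<Sum>(c2, es) \<leftarrow> map term_gate p.
      Mod 2 (c2 + (\<Sum>m<Suc n. es ! m * (rev b @ [z]) ! m))) :: z3) + of_nat (length p) =
    (-1) ^ z * eval_poly n p (map (\<lambda>x. (-1) ^ x) b)"
  using assms(1)
proof (induction p)
  case Nil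
  show ?case by (simp add: eval_poly_def)
next
  case (Cons t p)
  obtain c es where t: "t = (c, es)"
    by (cases t)
  then have c: "c \<noteq> 0" and es: "length es = n"
    using Cons.prems by auto
  let ?s = "\<Sum>i<n. es ! i * b ! i"
  have *: "(\<Prod>i<n. (map (\<lambda>x. (-1) ^ x) b ! i) ^ (es ! i)) = ((-1) ^ ?s :: z3)"
    using assms(2) by (simp add: power_sum mult.commute flip: power_mult)
  have "of_nat (Mod 2 (z3_rep c + (\<Sum>m<Suc n. (rev es @ [1]) ! m * (rev b @ [z]) ! m))) + 1 =
    c * (-1) ^ (z + ?s)"
    unfolding term_gate_input[OF es assms(2)] by (rule Mod2_gate[OF c])
  moreover have "(of_nat (\<Sum>(c2, es) \<leftarrow> map term_gate (t # p).
      Mod 2 (c2 + (\<Sum>m<Suc n. es ! m * (rev b @ [z]) ! m))) :: z3) + of_nat (length (t # p)) =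
    (of_nat (Mod 2 (z3_rep c + (\<Sum>m<Suc n. (rev es @ [1]) ! m * (rev b @ [z]) ! m))) + 1) +
    (of_nat (\<Sum>(c2, es) \<leftarrow> map term_gate p.
      Mod 2 (c2 + (\<Sum>m<Suc n. es ! m * (rev b @ [z]) ! m))) + of_nat (length p))"
    by (simp add: t term_gate_def del: sum.lessThan_Suc)
  moreover have "eval_poly n (t # p) (map (\<lambda>x. (-1) ^ x) b) =
    c * (-1) ^ ?s + eval_poly n p (map (\<lambda>x. (-1) ^ x) b)"
    by (simp add: eval_poly_def t *)
  ultimately show ?case
    using Cons.IH Cons.prems by (simp only: list.set ball_simps) (simp add: power_add algebra_simps)
qed

lemma poly_gates_sum:
  assumes "p \<in> expanded_polys n" "length b = n" "z \<in> {0, 1}"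
  shows "(\<Sum>(c1, gs) \<leftarrow> poly_gates p. Mod 3 (c1 + (\<Sum>(c2, es) \<leftarrow> gs.
      Mod 2 (c2 + (\<Sum>m<Suc n. es ! m * (rev b @ [z]) ! m))))) =
    (if eval_poly n p (map (\<lambda>x. (-1) ^ x) b) = (if z = 0 then 2 else 1) then 2 else 1)"
proof -
  let ?e = "eval_poly n p (map (\<lambda>x. (-1) ^ x) b)"
  let ?g = "\<lambda>(c2, es). Mod 2 (c2 + (\<Sum>m<Suc n. es ! m * (rev b @ [z]) ! m))"
  let ?t = "z3_rep (1 + of_nat (length p)) + sum_list (map ?g (map term_gate p))"
  have "\<forall>(c, es) \<in> set p. c \<noteq> 0 \<and> length es = n"
    using assms(1) by (auto simp: expanded_polys_def)
  from Mod3_gate[OF this assms(2), of z] have "of_nat ?t = 1 + (-1) ^ z * ?e"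
    by (simp only: of_nat_add of_nat_z3_rep add.assoc) (simp add: add.commute)
  then have "3 dvd ?t \<longleftrightarrow> 1 + (-1) ^ z * ?e = 0"
    by (simp only: of_nat_z3_eq_0[symmetric])
  \<comment> \<open>The equation is \<open>1 + ?e = 0\<close> for \<open>z = 0\<close> and
    \<open>1 - ?e = 0\<close> for \<open>z = 1\<close>.\<close>
  also have "\<dots> \<longleftrightarrow> ?e = (if z = 0 then 2 else 1)"
    using assms(3) by (cases ?e rule: z3_cases) auto
  finally have "Mod 3 ?t = (if ?e = (if z = 0 then 2 else 1) then 1 else 0)"
    by (simp only: Mod_def)
  moreover have "sum_list (map ?g (rev (map term_gate p))) = sum_list (map ?g (map term_gate p))"
    by (simp only: rev_map[symmetric] sum_list_rev)
  moreover have "Mod 3 0 = 1"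
    by (simp add: Mod_def)
  ultimately show ?thesis
    by (simp add: poly_gates_def del: map_map sum.lessThan_Suc)
qed

lemma eval_reduction:
  assumes "set ps \<subseteq> expanded_polys n" "length b = n" "z \<in> {0, 1}"
  shows "eval_circuit (reduction (n, ps)) (rev b @ [z]) = 1 \<longleftrightarrow>
    even (count_list (map (\<lambda>p. eval_poly n p (map (\<lambda>x. (-1) ^ x) b)) ps) (if z = 0 then 2 else 1)
      + length ps)"
proof -
  let ?h = "\<lambda>(c1, gs). Mod 3 (c1 + (\<Sum>(c2, es) \<leftarrow> gs.
      Mod 2 (c2 + (\<Sum>m<Suc n. es ! m * (rev b @ [z]) ! m))))"
  let ?c = "if z = 0 then 2 else 1 :: z3"
  have "sum_list (map ?h (concat (map poly_gates ps))) =
    count_list (map (\<lambda>p. eval_poly n p (map (\<lambda>x. (-1) ^ x) b)) ps) ?c + length ps"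
    using assms(1)
  proof (induction ps)
    case (Cons p ps)
    then have "sum_list (map ?h (poly_gates p)) =
      (if eval_poly n p (map (\<lambda>x. (-1) ^ x) b) = ?c then 2 else 1)"
      using poly_gates_sum[of p n b z] assms by simp
    moreover have "sum_list (map ?h (concat (map poly_gates ps))) =
      count_list (map (\<lambda>p. eval_poly n p (map (\<lambda>x. (-1) ^ x) b)) ps) ?c + length ps"
      using Cons by simp
    ultimately show ?case
      by (simp only: list.map concat.simps map_append sum_list_append) simp
  qed simp
  moreover have "sum_list (map ?h (rev (concat (map poly_gates ps)))) =
    sum_list (map ?h (concat (map poly_gates ps)))"
    by (simp only: rev_map[symmetric] sum_list_rev)
  ultimately show ?thesis
    by (simp only: reduction_def case_prod_conv eval_circuit.simps) (simp add: Mod_def)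
qed

section \<open>The field with four elements\<close>

lemma field_4:
  fixes \<alpha> :: "'f::field"
  assumes "CARD('f) = 4" "primitive_element \<alpha>"
  shows "(2 :: 'f) = 0" "\<alpha> \<noteq> 0" "\<alpha> ^ 2 = \<alpha> + 1"
proof -
  have fin: "finite (UNIV :: 'f set)"
    using assms(1) card.infinite by fastforce
  \<comment> \<open>Translation by 1 permutes the field, so comparing the two sums gives 4 =
    0.\<close>
  have "(\<Sum>x\<in>UNIV. x) = (\<Sum>x\<in>(UNIV :: 'f set). x + 1)"
    by (rule sum.reindex_bij_witness[of _ "\<lambda>x. x + 1" "\<lambda>x. x - 1"]) auto
  then have "(4 :: 'f) = 0"
    using assms(1) by (simp add: sum.distrib)
  moreover have "(4 :: 'f) = 2 * 2"
    by simp
  ultimately show two: "(2 :: 'f) = 0"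
    by (metis mult_eq_0_iff)
  have card: "card (range (\<lambda>i::nat. \<alpha> ^ i)) = 3"
    using assms fin by (simp add: primitive_element_def card_Diff_singleton)
  have "\<alpha> \<in> range (\<lambda>i::nat. \<alpha> ^ i)"
    by (metis power_one_right rangeI)
  then show 0: "\<alpha> \<noteq> 0"
    using assms(2) by (auto simp: primitive_element_def)
  have 1: "\<alpha> \<noteq> 1"
    using card by auto
  have neg: "- x = x" for x :: 'f
    using two by (metis add_eq_0_iff mult_2 mult_zero_left)
  have 2: "\<alpha> + 1 \<noteq> 0" "\<alpha> + 1 \<noteq> 1" "\<alpha> + 1 \<noteq> \<alpha>"
    using 0 1 neg[of 1] by (auto simp: add_eq_0_iff2)
  \<comment> \<open>Four distinct elements exhaust the field, and \<alpha> + 1 is the only possible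
    value left for the square.\<close>
  have "{0, 1, \<alpha>, \<alpha> + 1} = (UNIV :: 'f set)"
    using 0 1 2 fin assms(1) by (intro card_subset_eq) auto
  then have "\<alpha> ^ 2 \<in> {0, 1, \<alpha>, \<alpha> + 1}"
    by simp
  moreover have "\<alpha> ^ 2 \<noteq> 0" "\<alpha> ^ 2 \<noteq> \<alpha>"
    using 0 1 by (auto simp: power2_eq_square)
  moreover have "\<alpha> ^ 2 \<noteq> 1"
    using 1 neg[of 1] by (auto simp: power2_eq_1_iff)
  ultimately show "\<alpha> ^ 2 = \<alpha> + 1"
    by blast
qed

text \<open>Since \<open>\<alpha> ^ 2 = \<alpha> + 1\<close>, the sum is a combination of 1 and
  \<alpha>, in which only the parities of the coefficients count. Replacing \<open>?N 0\<close> by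
  the length turns the resulting conditions into the stated ones.\<close>

lemma power_sum_eq_0_iff:
  fixes \<alpha> :: "'f::field"
  assumes "CARD('f) = 4" "primitive_element \<alpha>"
  shows "(\<Sum>t \<leftarrow> ts. \<alpha> ^ z3_rep t) = 0 \<longleftrightarrow>
    even (count_list ts 2 + length ts) \<and> even (count_list ts 1 + length ts)"
proof -
  note F = field_4[OF assms]
  let ?N = "count_list ts"
  have len: "length ts = ?N 0 + ?N 1 + ?N 2"
  proof (induction ts)
    case (Cons t ts)
    then show ?case by (cases t rule: z3_cases) auto
  qed simp
  have par: "(of_nat m :: 'f) = of_bool (odd m)" for m
  proof (induction m)
    case (Suc m)
    have "(1 + 1 :: 'f) = 0"
      using F(1) by simp
    then show ?case
      using Suc by (cases "even m") auto
  qed simp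
  have sum: "(\<Sum>t \<leftarrow> ts. \<alpha> ^ z3_rep t) = of_nat (?N 0 + ?N 2) + of_nat (?N 1 + ?N 2) * \<alpha>"
  proof (induction ts)
    case (Cons t ts)
    then show ?case
      by (cases t rule: z3_cases) (auto simp: F(3) algebra_simps)
  qed simp
  \<comment> \<open>This excludes that both coefficients are odd.\<close>
  have "\<alpha> + 1 \<noteq> 0"
    using F(2,3) by (metis power_eq_0_iff)
  then have "(\<Sum>t \<leftarrow> ts. \<alpha> ^ z3_rep t) = 0 \<longleftrightarrow> even (?N 0 + ?N 2) \<and> even (?N 1 + ?N 2)"
    unfolding sum par using F(2)
    by (cases "even (?N 0 + ?N 2)"; cases "even (?N 1 + ?N 2)") (auto simp: add.commute)
  then show ?thesis
    unfolding len by auto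
qed

text \<open>A circuit input is a sign vector, written by exponents of -1 in reverse order, followed
  by the bit \<open>z\<close>; the two values of \<open>z\<close> test the two parity
  conditions.\<close>

lemma reduction_accepts:
  fixes \<alpha> :: "'f::field"
  assumes \<alpha>: "CARD('f) = 4" "primitive_element \<alpha>"
    and e: "e \<in> inputs (power_sum_problem \<alpha>)"
  shows "accepts (power_sum_problem \<alpha>) e \<longleftrightarrow> accepts cc232_equivalence_problem (reduction e)"
proof -
  obtain n ps where e_eq: "e = (n, ps)"
    by (cases e)
  then have ps: "set ps \<subseteq> expanded_polys n"
    using e by (simp add: power_sum_problem_def)
  let ?sg = "map (\<lambda>x. (-1) ^ x) :: nat list \<Rightarrow> z3 list"
  let ?ts = "\<lambda>a. map (\<lambda>p. eval_poly n p a) ps"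
  let ?A = "\<lambda>a. (\<Sum>i < length ps. \<alpha> ^ z3_rep (eval_poly n (ps ! i) a)) = 0"
  let ?B = "\<lambda>y. eval_circuit (reduction (n, ps)) y = 1"
  have A: "?A a \<longleftrightarrow>
      even (count_list (?ts a) 2 + length ps) \<and> even (count_list (?ts a) 1 + length ps)" for a
    using power_sum_eq_0_iff[OF \<alpha>, of "?ts a"]
    by (simp add: sum_list_sum_nth atLeast0LessThan)
  have A_B: "?A (?sg b) \<longleftrightarrow> ?B (rev b @ [0]) \<and> ?B (rev b @ [1])" if "length b = n" for b
    unfolding A using eval_reduction[OF ps that] by simp
  have "(\<forall>a. length a = n \<and> set a \<subseteq> {-1, 1} \<longrightarrow> ?A a) \<longleftrightarrow>
    (\<forall>y. length y = Suc n \<and> set y \<subseteq> {0, 1} \<longrightarrow> ?B y)"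
  proof (intro iffI allI impI)
    fix y :: "nat list"
    assume *: "\<forall>a. length a = n \<and> set a \<subseteq> {-1, 1} \<longrightarrow> ?A a"
      and y: "length y = Suc n \<and> set y \<subseteq> {0, 1}"
    define b where "b = rev (butlast y)"
    have y_eq: "y = rev b @ [last y]"
      using y by (metis b_def append_butlast_last_id list.size(3) nat.distinct(1) rev_rev_ident)
    have b: "length b = n" "set b \<subseteq> {0, 1}"
      using y by (auto simp: b_def dest: in_set_butlastD)
    then have "set (?sg b) \<subseteq> {-1, 1}"
      by auto
    then have "?A (?sg b)"
      using * b by simp
    moreover have "last y \<in> {0, 1}"
      using y by (metis last_in_set length_0_conv nat.distinct(1) subsetD)
    ultimately show "?B y"
      using A_B[OF b(1)] by (subst y_eq) auto
  next
    fix a :: "z3 list"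
    assume *: "\<forall>y. length y = Suc n \<and> set y \<subseteq> {0, 1} \<longrightarrow> ?B y"
      and a: "length a = n \<and> set a \<subseteq> {-1, 1}"
    define b where "b = map (\<lambda>x::z3. if x = 1 then 0 else 1 :: nat) a"
    have "?sg b = a"
      using a by (auto simp: b_def intro!: map_idI)
    moreover have "length b = n" "set b \<subseteq> {0, 1}"
      using a by (auto simp: b_def)
    moreover from this have "?B (rev b @ [0])" "?B (rev b @ [1])"
      using * by simp_all
    ultimately show "?A a"
      using A_B[of b] by simp
  qed
  then show ?thesis
    by (simp add: e_eq power_sum_problem_def cc232_equivalence_problem_def reduction_def)
qed

section \<open>Computing the reduction\<close>

text \<open>Coefficients, exponents and gate constants are all at most 2, so a finite control can
  handle their codes.\<close>

lemma enc_nat_simps: "enc_nat 0 = [3]" "enc_nat 1 = [2, 3]" "enc_nat 2 = [1, 2, 3]"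
  by (simp_all add: enc_nat_def binary.simps)

lemma enc_nat_z3_rep:
  obtains "enc_nat (z3_rep r) = [3]" | "enc_nat (z3_rep r) = [2, 3]" | "enc_nat (z3_rep r) = [1, 2, 3]"
  by (cases r rule: z3_cases) (use enc_nat_simps that in auto)

text \<open>The first argument of a state is one more than the number of terms read so far in the current
  polynomial, the second one is the coefficient of the current term. The parts of a gate are pushed
  in reverse order, so that both numbers are known when they have to be written.\<close>

datatype scan_state = Unary | List | Polys | Done | Terms z3 | Coeff z3 z3 | Exps z3 z3 | Skip z3 z3

text \<open>The first symbol of a code already determines a coefficient or an exponent; the rest is
  skipped.\<close>

fun scan_next :: "scan_state \<Rightarrow> nat \<Rightarrow> scan_state" where
  "scan_next Unary a = (if a = sym_end then List else Unary)"
| "scan_next List a = Polys"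
| "scan_next Polys a = (if a = sym_open then Terms 1 else Done)"
| "scan_next Done a = Done"
| "scan_next (Terms r) a = (if a = sym_close then Polys else Coeff r (if a = sym0 then 2 else 1))"
| "scan_next (Coeff r c) a = (if a = sym_open then Exps r c else Coeff r c)"
| "scan_next (Exps r c) a =
     (if a = sym_close then Terms (r + 1) else if a = sym_end then Exps r c else Skip r c)"
| "scan_next (Skip r c) a = (if a = sym_end then Exps r c else Skip r c)"

text \<open>The extra \<open>sym1\<close> counts the new variable, and the second
  \<open>sym_end\<close> encodes the constant 0 of the output gate.\<close>

fun scan_direct :: "scan_state \<Rightarrow> nat \<Rightarrow> nat list" where
  "scan_direct Unary a = (if a = sym_end then [sym1, sym_end, sym_end] else [sym1])"
| "scan_direct _ a = []"

text \<open>All codes are pushed backwards: \<open>[sym_close, sym_open, sym_end]\<close> is the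
  gate \<open>(0, [])\<close>, and \<open>[sym_end, sym1]\<close> after the bracket in
  \<open>Coeff\<close> is the multiplicity of the new variable.\<close>

fun scan_push :: "scan_state \<Rightarrow> nat \<Rightarrow> nat list" where
  "scan_push List a = [sym_close]"
| "scan_push Polys a = (if a = sym_open then [sym_close] else [sym_open])"
| "scan_push (Terms r) a =
     (if a = sym_close
      then sym_open # rev (enc_nat (z3_rep r)) @ [sym_close, sym_open, sym_end] else [])"
| "scan_push (Coeff r c) a = (if a = sym_open then [sym_close, sym_end, sym1] else [])"
| "scan_push (Exps r c) a =
     (if a = sym_close then sym_open # rev (enc_nat (z3_rep c))
      else if a = sym0 then [sym_end, sym1, sym0]
      else if a = sym1 then [sym_end, sym1] else [sym_end])"
| "scan_push _ a = []"

lemma finite_scan_state: "finite (UNIV :: scan_state set)"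
proof -
  have "UNIV = {Unary, List, Polys, Done} \<union> range Terms \<union>
    range (case_prod Coeff) \<union> range (case_prod Exps) \<union> range (case_prod Skip)"
    (is "_ = ?S")
  proof (intro set_eqI iffI UNIV_I)
    fix q
    show "q \<in> ?S" by (cases q) (auto simp: image_iff)
  qed
  then show ?thesis
    by (metis finite.emptyI finite_UnI finite_class.finite_UNIV finite_imageI finite_insert)
qed

text \<open>The letters of encodings are below 6, which leaves 6 as the stack marker. The longest
  emission has 1 + 3 + 3 letters, at the end of a polynomial.\<close>

interpretation scan: stack_transducer UNIV Unary scan_next scan_direct scan_push 6 7
proof
  fix q a
  show "set (scan_direct q a) \<subseteq> {..<6}" "length (scan_direct q a) \<le> 7"
    by (cases q; auto)+
  have "set (scan_push q a) \<subseteq> {..<6} \<and> length (scan_push q a) \<le> 7"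
  proof (cases q)
    case (Terms r)
    then show ?thesis
      by (cases r rule: enc_nat_z3_rep) auto
  next
    case (Exps r c)
    then show ?thesis
      by (cases c rule: enc_nat_z3_rep) auto
  qed auto
  then show "set (scan_push q a) \<subseteq> {..<6}" "length (scan_push q a) \<le> 7"
    by simp_all
qed (auto simp: finite_scan_state)

section \<open>Words emitted on encoded inputs\<close>

definition enc_term :: "z3 \<times> nat list \<Rightarrow> nat list" where
  "enc_term = (\<lambda>(c, es). enc_nat (z3_rep c) @ enc_list enc_nat es)"

definition enc_mod2_gate :: "mod2_gate \<Rightarrow> nat list" where
  "enc_mod2_gate = (\<lambda>(c2, es). enc_nat c2 @ enc_list enc_nat es)"

definition enc_mod3_gate :: "mod3_gate \<Rightarrow> nat list" where
  "enc_mod3_gate = (\<lambda>(c1, gs). enc_nat c1 @ enc_list enc_mod2_gate gs)"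

text \<open>This is why the reduction reverses its lists: pushing the reversed codes of the elements
  in reading order leaves the code of the reversed list.\<close>

lemma rev_enc_list: "rev (enc_list f (rev xs)) = sym_close # concat (map (rev \<circ> f) xs) @ [sym_open]"
  by (simp add: enc_list_def rev_concat rev_map)

lemma scan_Exps:
  assumes "set es \<subseteq> {0, 1, 2}"
  shows "foldl scan_next (Exps r c) (concat (map enc_nat es)) = Exps r c \<and>
    emission scan_next scan_push (Exps r c) (concat (map enc_nat es)) = concat (map (rev \<circ> enc_nat) es)"
  using assms
proof (induction es)
  case (Cons e es)
  then consider "e = 0" | "e = 1" | "e = 2"
    by auto
  then show ?case
    using Cons by cases (auto simp: emission_append enc_nat_simps simp del: One_nat_def)
qed simp

lemma scan_term:
  assumes "c \<noteq> 0" "set es \<subseteq> {0, 1, 2}"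
  shows "foldl scan_next (Terms r) (enc_term (c, es)) = Terms (r + 1) \<and>
    emission scan_next scan_push (Terms r) (enc_term (c, es)) =
      rev (enc_mod2_gate (term_gate (c, es)))"
proof -
  have *: "rev (enc_mod2_gate (term_gate (c, es))) =
    [sym_close, sym_end, sym1] @ concat (map (rev \<circ> enc_nat) es) @ sym_open # rev (enc_nat (z3_rep c))"
    \<comment> \<open>The multiplicities \<open>rev es @ [1]\<close> are
      \<open>rev (1 # es)\<close>.\<close>
    using rev_enc_list[of enc_nat "1 # es"]
    by (simp add: enc_mod2_gate_def term_gate_def enc_nat_simps del: One_nat_def)
  show ?thesis
    unfolding *
    using assms scan_Exps[OF assms(2), of r c]
    by (cases c rule: z3_cases)
      (auto simp: enc_term_def enc_list_def emission_append enc_nat_simps simp del: One_nat_def)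
qed

lemma scan_terms:
  assumes "\<forall>(c, es) \<in> set p. c \<noteq> 0 \<and> set es \<subseteq> {0, 1, 2}"
  shows "foldl scan_next (Terms r) (concat (map enc_term p)) = Terms (r + of_nat (length p)) \<and>
    emission scan_next scan_push (Terms r) (concat (map enc_term p)) =
      concat (map (rev \<circ> enc_mod2_gate) (map term_gate p))"
  using assms
proof (induction p arbitrary: r)
  case (Cons t p)
  obtain c es where t: "t = (c, es)"
    by (cases t)
  then have "c \<noteq> 0" "set es \<subseteq> {0, 1, 2}"
    using Cons.prems by auto
  from scan_term[OF this, of r] show ?case
    using Cons.IH[of "r + 1"] Cons.prems by (simp add: t emission_append add.assoc)
qed simp

lemma scan_poly:
  assumes "p \<in> expanded_polys n"
  shows "foldl scan_next Polys (enc_list enc_term p) = Polys \<and>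
    emission scan_next scan_push Polys (enc_list enc_term p) =
      concat (map (rev \<circ> enc_mod3_gate) (poly_gates p))"
proof -
  have "\<forall>(c, es) \<in> set p. c \<noteq> 0 \<and> set es \<subseteq> {0, 1, 2}"
    using assms by (auto simp: expanded_polys_def)
  \<comment> \<open>Starting at 1, the counter ends as the constant
    \<open>1 + of_nat (length p)\<close> of the gate.\<close>
  from scan_terms[OF this, of 1] show ?thesis
    by (simp add: enc_list_def[of enc_term] emission_append poly_gates_def enc_mod3_gate_def
        rev_enc_list enc_nat_simps) (simp add: enc_list_def)
qed

lemma scan_polys:
  assumes "set ps \<subseteq> expanded_polys n"
  shows "foldl scan_next Polys (concat (map (enc_list enc_term) ps)) = Polys \<and>
    emission scan_next scan_push Polys (concat (map (enc_list enc_term) ps)) =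
      concat (map (rev \<circ> enc_mod3_gate) (concat (map poly_gates ps)))"
  using assms by (induction ps) (auto simp: emission_append scan_poly)

lemma scan_unary:
  "foldl scan_next Unary (enc_unary n) = List \<and>
   emission scan_next scan_push Unary (enc_unary n) = [] \<and>
   emission scan_next scan_direct Unary (enc_unary n) = enc_unary (Suc n) @ enc_nat 0"
  by (induction n) (auto simp: enc_unary_def enc_nat_simps)

text \<open>Only \<open>Unary\<close> writes directly, and it is never entered again.\<close>

lemma scan_direct_empty: "q \<noteq> Unary \<Longrightarrow> emission scan_next scan_direct q w = []"
proof (induction w arbitrary: q)
  case (Cons a w)
  have "scan_next q a \<noteq> Unary" "scan_direct q a = []"
    using Cons.prems by (cases q; simp)+
  then show ?case
    using Cons.IH by simp
qed simp

lemma encode_power_sum_problem: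
  "encode (power_sum_problem \<alpha>) (n, ps) = enc_unary n @ enc_list (enc_list enc_term) ps"
  by (simp add: power_sum_problem_def enc_term_def)

lemma encode_reduction:
  "encode cc232_equivalence_problem (reduction (n, ps)) = enc_unary (Suc n) @ enc_nat 0 @
     enc_list enc_mod3_gate (rev (concat (map poly_gates ps)))"
proof -
  have "enc_mod3_gate = (\<lambda>(c1, gs). enc_nat c1 @
      enc_list (\<lambda>(c2, es). enc_nat c2 @ enc_list enc_nat es) gs)"
    by (simp add: enc_mod3_gate_def enc_mod2_gate_def)
  then show ?thesis
    by (simp add: cc232_equivalence_problem_def reduction_def)
qed

lemma scan_input:
  assumes "(n, ps) \<in> inputs (power_sum_problem \<alpha>)"
  defines "w \<equiv> encode (power_sum_problem \<alpha>) (n, ps)"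
  shows "emission scan_next scan_direct Unary w @ rev (emission scan_next scan_push Unary w) =
    encode cc232_equivalence_problem (reduction (n, ps))"
proof -
  have "set ps \<subseteq> expanded_polys n"
    using assms(1) by (simp add: power_sum_problem_def)
  from scan_polys[OF this] have "emission scan_next scan_push Unary w =
      rev (enc_list enc_mod3_gate (rev (concat (map poly_gates ps))))"
    using scan_unary[of n]
    by (simp add: w_def encode_power_sum_problem emission_append enc_list_def[of "enc_list enc_term"]
        rev_enc_list)
  moreover have "emission scan_next scan_direct Unary w = enc_unary (Suc n) @ enc_nat 0"
    using scan_unary[of n]
    by (simp add: w_def encode_power_sum_problem emission_append scan_direct_empty)
  ultimately show ?thesis
    by (simp add: encode_reduction)
qed

lemma set_enc_list: "(\<And>x. x \<in> set xs \<Longrightarrow> set (f x) \<subseteq> {0<..<6}) \<Longrightarrow> set (enc_list f xs) \<subseteq> {0<..<6}"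
  by (fastforce simp: enc_list_def)

lemma set_enc_nat: "set (enc_nat m) \<subseteq> {0<..<6}"
proof -
  have "set (binary m) \<subseteq> {0<..<6}"
    by (induction m rule: binary.induct) (subst binary.simps, auto)
  then show ?thesis
    by (simp add: enc_nat_def)
qed

text \<open>Encodings avoid the blank 0 and the marker 6, as \<open>scan.computes_emission\<close>
  requires.\<close>

lemma set_encode_power_sum_problem: "set (encode (power_sum_problem \<alpha>) e) \<subseteq> {0<..<6}"
proof -
  have "set (enc_term t) \<subseteq> {0<..<6}" for t
    using set_enc_nat set_enc_list[of _ enc_nat] by (cases t) (simp add: enc_term_def)
  then have "set (enc_list (enc_list enc_term) ps) \<subseteq> {0<..<6}" for ps
    by (intro set_enc_list)
  moreover have "set (enc_unary n) \<subseteq> {0<..<6}" for n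
    by (auto simp: enc_unary_def)
  ultimately show ?thesis
    by (cases e) (simp add: encode_power_sum_problem)
qed

lemma polytime_reduction:
  "polytime_transformation (power_sum_problem \<alpha>) cc232_equivalence_problem reduction"
  unfolding polytime_transformation_def
proof (intro conjI exI ballI)
  show "reduction ` inputs (power_sum_problem \<alpha>) \<subseteq> inputs cc232_equivalence_problem"
    using reduction_inputs by blast
  show "wf_tm scan.machine"
    by (rule scan.wf_machine)
  fix e assume "e \<in> inputs (power_sum_problem \<alpha>)"
  then show "computes_within scan.machine (encode (power_sum_problem \<alpha>) e)
      (encode cc232_equivalence_problem (reduction e))
      (poly [:3, 1 + 3 * 7:] (length (encode (power_sum_problem \<alpha>) e)))"
    using scan.computes_emission[OF set_encode_power_sum_problem, of \<alpha> e] scan_input[of _ _ \<alpha>]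
    by (cases e) simp
qed

theorem theorem7p2:
  fixes \<alpha> :: "'f::field"
  assumes "CARD('f) = 4"
    and "primitive_element \<alpha>"
  shows "polytime_reducible (power_sum_problem \<alpha>) cc232_equivalence_problem"
  unfolding polytime_reducible_def
  using polytime_reduction reduction_accepts[OF assms] by blast

end
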